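(* Let $d\ge 1$, $\sigma_d>0$, and $x,y\in\mathbb{R}^d$ with $x\neq y$. Let $(x',y')$ be the random pair in $\mathbb{R}^d\times\mathbb{R}^d$ output by the sampling procedure $\mathsf{MaxRefl}_d(x,y,\sigma_d)$ described in the context. Then $(x',y')$ is distributed according to a maximal reflection coupling of $\mathrm{N}(x,I_d\sigma_d^2)$ and $\mathrm{N}(y,I_d\sigma_d^2)$.
   Context: Couplings. For probability measures $\mu,\nu$ on $\mathbb{R}^d$ (Borel $\sigma$-algebra $\mathcal{B}$), a coupling of $\mu$ and $\nu$ is a probability measure on $\mathbb{R}^d\times\mathbb{R}^d$ with marginals $\mu$ and $\nu$. It is maximal if $(x',y')$ drawn from it satisfies $\mathbb{P}(x'=y')=1-\sup_{A\in\mathcal{B}}|\mu(A)-\nu(A)|$. With $e=(y-x)/\lVert y-x\rVert$, a maximal reflection coupling of $\mathrm{N}(x,I_d\sigma_d^2)$ and $\mathrm{N}(y,I_d\sigma_d^2)$ is a maximal coupling such that $x'\neq y'$ implies $\eta=(I_d-2ee^{\top})\xi$, where $\xi=x'-x$ and $\eta=y'-y$. Notation. $\mathrm{N}(\mu,\Sigma)$ is the multivariate normal law and $\mathrm{N}(z;\mu,\Sigma)$ its density at $z$; $\mathrm{Unif}$ is the uniform distribution on $[0,1]$; $^{\top}$ denotes transpose. One-dimensional procedure, for reals $u\neq v$ and $\sigma>0$: 1. Draw $u'\sim\mathrm{N}(u,\sigma^2)$ and, independently, $W\sim\mathrm{Unif}$. 2. If $W\,\mathrm{N}(u';u,\sigma^2)\le\mathrm{N}(u';v,\sigma^2)$,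 set $v'=u'$. 3. Otherwise set $\xi=u'-u$, $\eta=-\xi$, and $v'=v+\eta$. 4. Return $(u',v')$. It is known that the output follows a maximal reflection coupling of $\mathrm{N}(u,\sigma^2)$ and $\mathrm{N}(v,\sigma^2)$ on $\mathbb{R}$. Procedure $\mathsf{MaxRefl}_d(x,y,\sigma_d)$ (draws in different steps are independent): 1. Compute $e=(y-x)/\lVert y-x\rVert$, $m=(y+x)/2$, $x_1=e^{\top}x$, $y_1=e^{\top}y$, and $m_{-1}=(I_d-ee^{\top})m$. 2. Draw $(x_1',y_1')$ by running the one-dimensional procedure with $u=x_1$, $v=y_1$, $\sigma=\sigma_d$. 3. Draw $\zeta\sim\mathrm{N}(0,I_d\sigma_d^2)$, set $\zeta_{-1}=(I_d-ee^{\top})\zeta$, $x'=x_1'e+m_{-1}+\zeta_{-1}$, and $y'=y_1'e+m_{-1}+\zeta_{-1}$. 4. Return $(x',y')$. *)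

theory Defs
  imports "HOL-Probability.Probability"
begin

text \<open>The covariance matrix is meant to be positive definite.\<close>

definition mvnormal_density :: "real ^ 'n \<Rightarrow> real ^ 'n ^ 'n \<Rightarrow> real ^ 'n \<Rightarrow> real" where
  "mvnormal_density \<mu> S z =
     exp (- ((z - \<mu>) \<bullet> (matrix_inv S *v (z - \<mu>))) / 2) / sqrt ((2 * pi) ^ CARD('n) * det S)"

definition mvnormal :: "real ^ 'n \<Rightarrow> real ^ 'n ^ 'n \<Rightarrow> (real ^ 'n) measure" where
  "mvnormal \<mu> S = density lborel (\<lambda>z. ennreal (mvnormal_density \<mu> S z))"

text \<open>As in \<^const>\<open>normal_density\<close>, the parameter \<open>\<sigma>\<close> is the standard deviation.\<close>

definition normal :: "real \<Rightarrow> real \<Rightarrow> real measure" where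
  "normal u \<sigma> = density lborel (\<lambda>z. ennreal (normal_density u \<sigma> z))"

definition coupling :: "'a::topological_space measure \<Rightarrow> 'a measure \<Rightarrow> ('a \<times> 'a) measure \<Rightarrow> bool" where
  "coupling \<mu> \<nu> P \<longleftrightarrow>
     prob_space P \<and> sets P = sets (borel \<Otimes>\<^sub>M borel) \<and>
     distr P borel fst = \<mu> \<and> distr P borel snd = \<nu>"

definition maximal_coupling ::
    "'a::topological_space measure \<Rightarrow> 'a measure \<Rightarrow> ('a \<times> 'a) measure \<Rightarrow> bool" where
  "maximal_coupling \<mu> \<nu> P \<longleftrightarrow>
     coupling \<mu> \<nu> P \<and>
     \<P>(p in P. fst p = snd p) = 1 - (SUP A\<in>sets borel. \<bar>measure \<mu> A - measure \<nu> A\<bar>)"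

definition unit_dir :: "real ^ 'n \<Rightarrow> real ^ 'n \<Rightarrow> real ^ 'n" where
  "unit_dir x y = (y - x) /\<^sub>R norm (y - x)"

definition outer :: "real ^ 'n \<Rightarrow> real ^ 'n ^ 'n" where
  "outer e = (\<chi> i j. e $ i * e $ j)"

text \<open>
  A coupling is a law on pairs, so the reflection condition on its draws is
  imposed almost surely.
\<close>

definition maximal_reflection_coupling ::
    "real ^ 'n \<Rightarrow> real ^ 'n \<Rightarrow> real \<Rightarrow> ((real ^ 'n) \<times> (real ^ 'n)) measure \<Rightarrow> bool" where
  "maximal_reflection_coupling x y \<sigma> P \<longleftrightarrow>
     maximal_coupling (mvnormal x (\<sigma>\<^sup>2 *\<^sub>R mat 1)) (mvnormal y (\<sigma>\<^sup>2 *\<^sub>R mat 1)) P \<and>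
     (AE (x', y') in P. x' \<noteq> y' \<longrightarrow>
        (let e = unit_dir x y; \<xi> = x' - x; \<eta> = y' - y
         in \<eta> = (mat 1 - 2 *\<^sub>R outer e) *v \<xi>))"

text \<open>
  A procedure is represented by the law of its output: the image of the product
  of the laws of its independent draws under the map that computes the output.
\<close>

definition max_refl_1d :: "real \<Rightarrow> real \<Rightarrow> real \<Rightarrow> (real \<times> real) measure" where
  "max_refl_1d u v \<sigma> =
     distr (normal u \<sigma> \<Otimes>\<^sub>M uniform_measure lborel {0..1}) (borel \<Otimes>\<^sub>M borel)
       (\<lambda>(u', w).
          if w * normal_density u \<sigma> u' \<le> normal_density v \<sigma> u' then (u', u')
          else (let \<xi> = u' - u; \<eta> = - \<xi> in (u', v + \<eta>)))"

definition max_refl ::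
    "real ^ 'n \<Rightarrow> real ^ 'n \<Rightarrow> real \<Rightarrow> ((real ^ 'n) \<times> (real ^ 'n)) measure" where
  "max_refl x y \<sigma> =
     (let e = unit_dir x y;
          m = (y + x) /\<^sub>R 2;
          x1 = e \<bullet> x;
          y1 = e \<bullet> y;
          m_perp = (mat 1 - outer e) *v m
      in distr (max_refl_1d x1 y1 \<sigma> \<Otimes>\<^sub>M mvnormal 0 (\<sigma>\<^sup>2 *\<^sub>R mat 1)) (borel \<Otimes>\<^sub>M borel)
           (\<lambda>((x1', y1'), \<zeta>).
              let \<zeta>_perp = (mat 1 - outer e) *v \<zeta>
              in (x1' *\<^sub>R e + m_perp + \<zeta>_perp, y1' *\<^sub>R e + m_perp + \<zeta>_perp)))"

end

theory Submission
  imports Defs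
begin

text \<open>
  The swap of \<open>t\<close> and \<open>e \<bullet> \<zeta>\<close> in \<open>\<real> \<times> \<real>\<^sup>d\<close> is orthogonal, so it preserves the standard Gaussian
  law of \<open>(t, \<zeta>)\<close>; hence \<open>t *\<^sub>R e + (I - e e\<^sup>T) \<zeta>\<close> is Gaussian and both marginals of the
  \<open>d\<close>-dimensional output reduce to those of the one-dimensional one. No change of variables for
  linear maps is needed, because the swap is a composition of three shears.

  For maximality, let \<open>c\<close> be the midpoint of \<open>u < v\<close>. Almost surely the one-dimensional output
  satisfies \<open>u' = v'\<close> or \<open>u' < c < v'\<close>. Hence the half-space \<open>e \<bullet> z < c\<close> attains the bound
  \<open>\<bar>\<mu> A - \<nu> A\<bar> \<le> P(x' \<noteq> y')\<close>, valid for every coupling.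
\<close>

subsection \<open>Isotropic Gaussian measures\<close>

lemma scaleR_mat: "c *\<^sub>R (mat a :: real ^ 'n ^ 'n) = mat (c * a)"
  by (simp add: mat_def vec_eq_iff)

lemma scaleR_mat_1: "c *\<^sub>R (mat 1 :: real ^ 'n ^ 'n) = mat c"
  by (simp add: scaleR_mat)

text \<open>\<open>matrix_inv\<close> is a \<open>SOME\<close> choice, so an inverse is exhibited
  first. Multiplying on the left by \<open>mat (1 / c)\<close> then determines the chosen
  matrix.\<close>

lemma matrix_inv_mat:
  assumes "c \<noteq> 0"
  shows "matrix_inv (mat c :: real ^ 'n ^ 'n) = mat (1 / c)"
proof -
  have mult: "mat a ** mat b = (mat (a * b) :: real ^ 'n ^ 'n)" for a b
    using scalar_matrix_assoc[of a "mat 1 :: real ^ 'n ^ 'n" "mat b"]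
    by (simp add: scaleR_mat_1 scaleR_mat)
  have "\<exists>A'. (mat c :: real ^ 'n ^ 'n) ** A' = mat 1 \<and> A' ** mat c = mat 1"
    using assms by (intro exI[of _ "mat (1 / c)"]) (simp add: mult)
  then have inv: "mat c ** matrix_inv (mat c) = (mat 1 :: real ^ 'n ^ 'n)"
    unfolding matrix_inv_def by (rule someI2_ex) simp
  have "matrix_inv (mat c :: real ^ 'n ^ 'n) = mat (1 / c) ** mat c ** matrix_inv (mat c)"
    using assms by (simp add: mult)
  also have "\<dots> = mat (1 / c)"
    by (simp add: inv flip: matrix_mul_assoc)
  finally show ?thesis .
qed

text \<open>Only the distance from \<open>z\<close> to the mean enters. This is the source of the
  translation and rotation symmetries used in \<open>distr_replace_coordinate\<close>.\<close>

lemma mvnormal_density_isotropic: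
  fixes \<mu> z :: "real ^ 'n"
  assumes "\<sigma> > 0"
  shows "mvnormal_density \<mu> (\<sigma>\<^sup>2 *\<^sub>R mat 1) z =
    exp (- (norm (z - \<mu>))\<^sup>2 / (2 * \<sigma>\<^sup>2)) / sqrt (2 * pi * \<sigma>\<^sup>2) ^ CARD('n)"
proof -
  have det: "det (mat (\<sigma>\<^sup>2) :: real ^ 'n ^ 'n) = (\<sigma>\<^sup>2) ^ CARD('n)"
    by (simp add: det_diagonal mat_def)
  have mult: "mat (1 / \<sigma>\<^sup>2) *v w = (1 / \<sigma>\<^sup>2) *\<^sub>R w" for w :: "real ^ 'n"
    using scaleR_matrix_vector_assoc[of "1 / \<sigma>\<^sup>2" "mat 1" w] by (simp add: scaleR_mat_1)
  have sqrt: "(sqrt (2 * pi * \<sigma>\<^sup>2)) ^ CARD('n) = sqrt ((2 * pi) ^ CARD('n) * (\<sigma>\<^sup>2) ^ CARD('n))"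
    by (simp only: real_sqrt_power[symmetric] power_mult_distrib)
  have inv: "matrix_inv (mat (\<sigma>\<^sup>2) :: real ^ 'n ^ 'n) = mat (1 / \<sigma>\<^sup>2)"
    using assms by (intro matrix_inv_mat) simp
  show ?thesis
    unfolding mvnormal_density_def scaleR_mat_1 inv det mult sqrt power2_norm_eq_inner
    by simp
qed

text \<open>The squared norm is a sum over coordinates, so the exponential factors. The product form
  reduces the total mass to one-dimensional integrals in \<open>prob_space_mvnormal\<close>.\<close>

lemma mvnormal_density_eq_prod:
  fixes \<mu> z :: "real ^ 'n"
  assumes "\<sigma> > 0"
  shows "mvnormal_density \<mu> (\<sigma>\<^sup>2 *\<^sub>R mat 1) z =
    (\<Prod>b\<in>Basis. normal_density (\<mu> \<bullet> b) \<sigma> (z \<bullet> b))"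
proof -
  have "(\<Sum>b\<in>Basis. - (z \<bullet> b - \<mu> \<bullet> b)\<^sup>2 / (2 * \<sigma>\<^sup>2)) = - (norm (z - \<mu>))\<^sup>2 / (2 * \<sigma>\<^sup>2)"
    unfolding power2_norm_eq_inner euclidean_inner[of "z - \<mu>" "z - \<mu>"]
    by (simp add: power2_eq_square inner_diff_left sum_negf sum_divide_distrib)
  then have "exp (- (norm (z - \<mu>))\<^sup>2 / (2 * \<sigma>\<^sup>2)) =
      (\<Prod>b\<in>Basis. exp (- (z \<bullet> b - \<mu> \<bullet> b)\<^sup>2 / (2 * \<sigma>\<^sup>2)))"
    by (subst exp_sum[symmetric]) (simp_all only: finite_Basis)
  then show ?thesis
    unfolding mvnormal_density_isotropic[OF assms] normal_density_def prod.distrib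
    by (simp add: power_one_over)
qed

lemma mvnormal_density_measurable [measurable]:
  "mvnormal_density \<mu> S \<in> borel_measurable borel"
proof -
  have [measurable]: "(*v) (matrix_inv S) \<in> borel_measurable borel"
    by (intro borel_measurable_continuous_onI linear_continuous_on matrix_vector_mul_bounded_linear)
  show ?thesis
    unfolding mvnormal_density_def[abs_def] by measurable
qed

lemma sets_mvnormal [simp, measurable_cong]: "sets (mvnormal \<mu> S) = sets borel"
  by (simp add: mvnormal_def)

lemma space_mvnormal [simp]: "space (mvnormal \<mu> S) = UNIV"
  by (simp add: mvnormal_def)

lemma sets_normal [simp, measurable_cong]: "sets (normal u \<sigma>) = sets borel"
  by (simp add: normal_def)

lemma space_normal [simp]: "space (normal u \<sigma>) = UNIV"
  by (simp add: normal_def)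

lemma nn_integral_normal_density:
  assumes "\<sigma> > 0"
  shows "(\<integral>\<^sup>+t. ennreal (normal_density u \<sigma> t) \<partial>lborel) = 1"
  using assms by (simp add: nn_integral_eq_integral normal_density_nonneg)

lemma prob_space_normal: "\<sigma> > 0 \<Longrightarrow> prob_space (normal u \<sigma>)"
  unfolding normal_def by (rule prob_space_normal_density)

lemma prob_space_mvnormal:
  fixes \<mu> :: "real ^ 'n"
  assumes "\<sigma> > 0"
  shows "prob_space (mvnormal \<mu> (\<sigma>\<^sup>2 *\<^sub>R mat 1))"
proof
  have "emeasure (mvnormal \<mu> (\<sigma>\<^sup>2 *\<^sub>R mat 1)) UNIV =
      (\<integral>\<^sup>+z. (\<Prod>b\<in>Basis. ennreal (normal_density (\<mu> \<bullet> b) \<sigma> (z \<bullet> b))) \<partial>lborel)"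
    by (simp add: mvnormal_def emeasure_density mvnormal_density_eq_prod[OF assms]
        prod_ennreal normal_density_nonneg)
  also have "\<dots> = 1"
    by (subst nn_integral_lborel_prod) (simp_all add: nn_integral_normal_density[OF assms])
  finally show "emeasure (mvnormal \<mu> (\<sigma>\<^sup>2 *\<^sub>R mat 1)) (space (mvnormal \<mu> (\<sigma>\<^sup>2 *\<^sub>R mat 1))) = 1"
    by simp
qed

section \<open>Exchanging a Gaussian coordinate with an independent draw\<close>

lemma nn_integral_lborel_translation:
  fixes f :: "'a::euclidean_space \<Rightarrow> ennreal"
  assumes [measurable]: "f \<in> borel_measurable borel"
  shows "(\<integral>\<^sup>+z. f (a + z) \<partial>lborel) = (\<integral>\<^sup>+z. f z \<partial>lborel)"
proof -
  have "(\<integral>\<^sup>+z. f z \<partial>lborel) = (\<integral>\<^sup>+z. f z \<partial>distr lborel borel ((+) a))"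
    by (simp add: lborel_distr_plus)
  also have "\<dots> = (\<integral>\<^sup>+z. f (a + z) \<partial>lborel)"
    by (subst nn_integral_distr) simp_all
  finally show ?thesis by simp
qed

text \<open>With one variable fixed, each substitution is an isometry of the other: first
  \<open>t = e \<bullet> z + s\<close>, then a translation of \<open>z\<close> by
  \<open>s *\<^sub>R e\<close>, and last \<open>t = e \<bullet> z - s\<close>, whose sign change is
  invisible to Lebesgue measure. Tonelli changes which variable is inner.\<close>

lemma nn_integral_swap_coordinate:
  fixes e :: "'a::euclidean_space" and F :: "real \<times> 'a \<Rightarrow> ennreal"
  assumes e: "norm e = 1" and F [measurable]: "F \<in> borel_measurable (borel \<Otimes>\<^sub>M borel)"
  shows "(\<integral>\<^sup>+z. \<integral>\<^sup>+t. F (e \<bullet> z, t *\<^sub>R e + (z - (e \<bullet> z) *\<^sub>R e)) \<partial>lborel \<partial>lborel) =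
    (\<integral>\<^sup>+z. \<integral>\<^sup>+t. F (t, z) \<partial>lborel \<partial>lborel)"
proof -
  have ee: "e \<bullet> e = 1"
    using e by (simp add: norm_eq_1)
  have "(\<integral>\<^sup>+z. \<integral>\<^sup>+t. F (e \<bullet> z, t *\<^sub>R e + (z - (e \<bullet> z) *\<^sub>R e)) \<partial>lborel \<partial>lborel) =
      (\<integral>\<^sup>+z. \<integral>\<^sup>+s. F (e \<bullet> z, s *\<^sub>R e + z) \<partial>lborel \<partial>lborel)"
  proof (rule nn_integral_cong)
    fix z :: 'a
    show "(\<integral>\<^sup>+t. F (e \<bullet> z, t *\<^sub>R e + (z - (e \<bullet> z) *\<^sub>R e)) \<partial>lborel) =
        (\<integral>\<^sup>+s. F (e \<bullet> z, s *\<^sub>R e + z) \<partial>lborel)"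
      by (subst nn_integral_lborel_translation[where a = "e \<bullet> z", symmetric])
        (simp_all add: algebra_simps)
  qed
  also have "\<dots> = (\<integral>\<^sup>+s. \<integral>\<^sup>+z. F (e \<bullet> z, s *\<^sub>R e + z) \<partial>lborel \<partial>lborel)"
    by (rule lborel_pair.Fubini'[symmetric]) measurable
  also have "\<dots> = (\<integral>\<^sup>+s. \<integral>\<^sup>+z. F (e \<bullet> z - s, z) \<partial>lborel \<partial>lborel)"
  proof (rule nn_integral_cong)
    fix s :: real
    show "(\<integral>\<^sup>+z. F (e \<bullet> z, s *\<^sub>R e + z) \<partial>lborel) = (\<integral>\<^sup>+z. F (e \<bullet> z - s, z) \<partial>lborel)"
      by (subst (2) nn_integral_lborel_translation[where a = "s *\<^sub>R e", symmetric])
        (simp_all add: inner_add_right ee)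
  qed
  also have "\<dots> = (\<integral>\<^sup>+z. \<integral>\<^sup>+s. F (e \<bullet> z - s, z) \<partial>lborel \<partial>lborel)"
    by (rule lborel_pair.Fubini'[symmetric]) measurable
  also have "\<dots> = (\<integral>\<^sup>+z. \<integral>\<^sup>+t. F (t, z) \<partial>lborel \<partial>lborel)"
  proof (rule nn_integral_cong)
    fix z :: 'a
    show "(\<integral>\<^sup>+s. F (e \<bullet> z - s, z) \<partial>lborel) = (\<integral>\<^sup>+t. F (t, z) \<partial>lborel)"
      by (subst (2) nn_integral_real_affine[where t = "e \<bullet> z" and c = "-1"]) simp_all
  qed
  finally show ?thesis .
qed

text \<open>The product law is turned into a Lebesgue integral with \<open>t\<close> innermost, the
  form to which \<open>nn_integral_swap_coordinate\<close> applies.\<close>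

lemma nn_integral_normal_mvnormal:
  fixes \<mu> :: "real ^ 'n"
  assumes "\<sigma> > 0" and [measurable]: "f \<in> borel_measurable (borel \<Otimes>\<^sub>M borel)"
  shows "(\<integral>\<^sup>+p. f p \<partial>(normal a \<sigma> \<Otimes>\<^sub>M mvnormal \<mu> (\<sigma>\<^sup>2 *\<^sub>R mat 1))) =
    (\<integral>\<^sup>+z. \<integral>\<^sup>+t. ennreal (normal_density a \<sigma> t * mvnormal_density \<mu> (\<sigma>\<^sup>2 *\<^sub>R mat 1) z) * f (t, z)
      \<partial>lborel \<partial>lborel)"
proof -
  interpret N: prob_space "normal a \<sigma>" by (rule prob_space_normal[OF assms(1)])
  interpret Z: prob_space "mvnormal \<mu> (\<sigma>\<^sup>2 *\<^sub>R mat 1)" by (rule prob_space_mvnormal[OF assms(1)])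
  interpret pair_sigma_finite "normal a \<sigma>" "mvnormal \<mu> (\<sigma>\<^sup>2 *\<^sub>R mat 1)" ..
  have "(\<integral>\<^sup>+p. f p \<partial>(normal a \<sigma> \<Otimes>\<^sub>M mvnormal \<mu> (\<sigma>\<^sup>2 *\<^sub>R mat 1))) =
      (\<integral>\<^sup>+z. \<integral>\<^sup>+t. f (t, z) \<partial>normal a \<sigma> \<partial>mvnormal \<mu> (\<sigma>\<^sup>2 *\<^sub>R mat 1))"
    by (rule nn_integral_snd[symmetric]) simp
  also have "\<dots> = (\<integral>\<^sup>+z. ennreal (mvnormal_density \<mu> (\<sigma>\<^sup>2 *\<^sub>R mat 1) z) *
      (\<integral>\<^sup>+t. ennreal (normal_density a \<sigma> t) * f (t, z) \<partial>lborel) \<partial>lborel)"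
    by (simp add: mvnormal_def normal_def nn_integral_density)
  also have "\<dots> = (\<integral>\<^sup>+z. \<integral>\<^sup>+t. ennreal (mvnormal_density \<mu> (\<sigma>\<^sup>2 *\<^sub>R mat 1) z) *
      (ennreal (normal_density a \<sigma> t) * f (t, z)) \<partial>lborel \<partial>lborel)"
    by (subst nn_integral_cmult) simp_all
  finally show ?thesis
    by (simp add: ennreal_mult' normal_density_nonneg ac_simps)
qed

lemma distr_replace_coordinate:
  fixes \<mu> e :: "real ^ 'n"
  assumes s: "\<sigma> > 0" and e: "norm e = 1"
  shows "distr (normal (e \<bullet> \<mu>) \<sigma> \<Otimes>\<^sub>M mvnormal 0 (\<sigma>\<^sup>2 *\<^sub>R mat 1)) borel
      (\<lambda>(t, z). t *\<^sub>R e + (\<mu> - (e \<bullet> \<mu>) *\<^sub>R e) + (z - (e \<bullet> z) *\<^sub>R e)) =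
    mvnormal \<mu> (\<sigma>\<^sup>2 *\<^sub>R mat 1)"
    (is "distr ?P borel ?h = ?M")
proof (rule measure_eqI)
  have ee: "e \<bullet> e = 1"
    using e by (simp add: norm_eq_1)
  define g where "g = mvnormal_density (0 :: real ^ 'n) (\<sigma>\<^sup>2 *\<^sub>R mat 1)"
  have [measurable]: "g \<in> borel_measurable borel"
    by (simp add: g_def)
  have g_diff: "g (z - \<mu>) = mvnormal_density \<mu> (\<sigma>\<^sup>2 *\<^sub>R mat 1) z" for z
    by (simp add: g_def mvnormal_density_isotropic[OF s])
  \<comment> \<open>The joint density depends only on \<open>t\<^sup>2 + (norm z)\<^sup>2\<close>.
    By Pythagoras, exchanging \<open>t\<close> with the coordinate of \<open>z\<close> along
    \<open>e\<close> keeps this sum.\<close>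
  have swap: "normal_density 0 \<sigma> t * g z =
      normal_density 0 \<sigma> (e \<bullet> z) * g (t *\<^sub>R e + (z - (e \<bullet> z) *\<^sub>R e))" for t z
  proof -
    have norm: "(norm (t *\<^sub>R e + (z - (e \<bullet> z) *\<^sub>R e)))\<^sup>2 = t\<^sup>2 + (norm z)\<^sup>2 - (e \<bullet> z)\<^sup>2"
      unfolding power2_norm_eq_inner
      by (simp add: inner_add_left inner_add_right inner_diff_left inner_diff_right ee
          inner_commute[of z e] power2_eq_square)
    have density: "normal_density 0 \<sigma> a * g w = exp (- (a\<^sup>2 + (norm w)\<^sup>2) / (2 * \<sigma>\<^sup>2)) /
        (sqrt (2 * pi * \<sigma>\<^sup>2) * sqrt (2 * pi * \<sigma>\<^sup>2) ^ CARD('n))" for a and w :: "real ^ 'n"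
      by (simp add: g_def mvnormal_density_isotropic[OF s] normal_density_def diff_divide_distrib
          mult_exp_exp)
    show ?thesis
      unfolding density norm by simp
  qed
  show "sets (distr ?P borel ?h) = sets ?M" by simp
  fix A assume "A \<in> sets (distr ?P borel ?h)"
  then have [measurable]: "A \<in> sets borel" by simp
  have [measurable]: "?h \<in> borel_measurable ?P" by measurable
  have "emeasure (distr ?P borel ?h) A = (\<integral>\<^sup>+p. indicator A (?h p) \<partial>?P)"
    by (simp add: nn_integral_distr flip: nn_integral_indicator)
  also have "\<dots> = (\<integral>\<^sup>+z. \<integral>\<^sup>+t. ennreal (normal_density (e \<bullet> \<mu>) \<sigma> t * g z) * indicator A (?h (t, z))
      \<partial>lborel \<partial>lborel)"
    unfolding g_def by (rule nn_integral_normal_mvnormal[OF s]) measurable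
  \<comment> \<open>Centring \<open>t\<close> supplies the missing component of \<open>\<mu>\<close>
    along \<open>e\<close>, so the output becomes \<open>\<mu>\<close> plus the swapped
    vector.\<close>
  also have "\<dots> = (\<integral>\<^sup>+z. \<integral>\<^sup>+t. ennreal (normal_density 0 \<sigma> t * g z) *
      indicator A (\<mu> + (t *\<^sub>R e + (z - (e \<bullet> z) *\<^sub>R e))) \<partial>lborel \<partial>lborel)"
  proof (rule nn_integral_cong)
    fix z :: "real ^ 'n"
    show "(\<integral>\<^sup>+t. ennreal (normal_density (e \<bullet> \<mu>) \<sigma> t * g z) * indicator A (?h (t, z)) \<partial>lborel) =
        (\<integral>\<^sup>+t. ennreal (normal_density 0 \<sigma> t * g z) *
          indicator A (\<mu> + (t *\<^sub>R e + (z - (e \<bullet> z) *\<^sub>R e))) \<partial>lborel)"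
      by (subst nn_integral_lborel_translation[where a = "e \<bullet> \<mu>", symmetric])
        (simp_all add: normal_density_def algebra_simps)
  qed
  \<comment> \<open>By \<open>swap\<close> the density may be read at the swapped point, where the
    indicator is evaluated already. Undoing the swap leaves an indicator free of \<open>t\<close>,
    and \<open>t\<close> can be integrated out.\<close>
  also have "\<dots> = (\<integral>\<^sup>+z. \<integral>\<^sup>+t. ennreal (normal_density 0 \<sigma> t * g z) * indicator A (\<mu> + z)
      \<partial>lborel \<partial>lborel)"
    using nn_integral_swap_coordinate[OF e, of "\<lambda>(t, z).
      ennreal (normal_density 0 \<sigma> t * g z) * indicator A (\<mu> + z)"]
    by (simp flip: swap)
  also have "\<dots> = (\<integral>\<^sup>+z. ennreal (g z) * indicator A (\<mu> + z) \<partial>lborel)"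
  proof (rule nn_integral_cong)
    fix z :: "real ^ 'n"
    have "(\<integral>\<^sup>+t. ennreal (normal_density 0 \<sigma> t * g z) * indicator A (\<mu> + z) \<partial>lborel) =
        (\<integral>\<^sup>+t. ennreal (normal_density 0 \<sigma> t) * (ennreal (g z) * indicator A (\<mu> + z)) \<partial>lborel)"
      by (simp add: ennreal_mult'[OF normal_density_nonneg] mult.assoc)
    also have "\<dots> = ennreal (g z) * indicator A (\<mu> + z)"
      by (subst nn_integral_multc) (simp_all add: nn_integral_normal_density[OF s])
    finally show "(\<integral>\<^sup>+t. ennreal (normal_density 0 \<sigma> t * g z) * indicator A (\<mu> + z) \<partial>lborel) =
        ennreal (g z) * indicator A (\<mu> + z)" .
  qed
  also have "\<dots> = (\<integral>\<^sup>+z. ennreal (g (z - \<mu>)) * indicator A z \<partial>lborel)"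
    by (subst (2) nn_integral_lborel_translation[where a = \<mu>, symmetric]) simp_all
  also have "\<dots> = emeasure ?M A"
    unfolding g_diff by (simp add: mvnormal_def emeasure_density)
  finally show "emeasure (distr ?P borel ?h) A = emeasure ?M A" .
qed

subsection \<open>The one-dimensional procedure\<close>

lemma measurable_max_refl_1d:
  "(\<lambda>(u', w). if w * normal_density u \<sigma> u' \<le> normal_density v \<sigma> u' then (u', u')
      else (let \<xi> = u' - u; \<eta> = - \<xi> in (u', v + \<eta>)))
    \<in> normal u \<sigma> \<Otimes>\<^sub>M uniform_measure lborel {0..1} \<rightarrow>\<^sub>M borel \<Otimes>\<^sub>M borel"
  unfolding Let_def by measurable

lemma prob_space_unit_interval: "prob_space (uniform_measure lborel {0..1::real})"
  by (rule prob_space_uniform_measure) simp_all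

lemma sets_max_refl_1d [simp, measurable_cong]:
  "sets (max_refl_1d u v \<sigma>) = sets (borel \<Otimes>\<^sub>M borel)"
  by (simp add: max_refl_1d_def)

lemma prob_space_max_refl_1d:
  assumes "\<sigma> > 0"
  shows "prob_space (max_refl_1d u v \<sigma>)"
proof -
  interpret N: prob_space "normal u \<sigma>" by (rule prob_space_normal[OF assms])
  interpret W: prob_space "uniform_measure lborel {0..1::real}" by (rule prob_space_unit_interval)
  interpret pair_prob_space "normal u \<sigma>" "uniform_measure lborel {0..1::real}" ..
  show ?thesis
    unfolding max_refl_1d_def by (rule prob_space_distr) (rule measurable_max_refl_1d)
qed

text \<open>With \<open>r\<close> the density ratio at a proposed point, this is the conditional
  probability of acceptance. The companion for \<open>{r<..}\<close> gives that of
  rejection.\<close>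

lemma emeasure_unit_interval_atMost:
  assumes "0 \<le> r"
  shows "emeasure (uniform_measure lborel {0..1::real}) {..r} = ennreal (min 1 r)"
proof -
  have "{0..1} \<inter> {..r} = {0..min 1 r}" by auto
  then show ?thesis
    using assms divide_ennreal[of "min 1 r" 1] by simp
qed

lemma emeasure_unit_interval_greaterThan:
  assumes "0 \<le> r"
  shows "emeasure (uniform_measure lborel {0..1::real}) {r<..} = ennreal (1 - min 1 r)"
proof -
  have "{0..1} \<inter> {r<..} = {min 1 r<..1}" using assms by auto
  then show ?thesis
    using assms divide_ennreal[of "1 - min 1 r" 1] by simp
qed

text \<open>A rejected draw \<open>t\<close> is sent to \<open>v - (t - u) = u + v - t\<close>, its
  mirror image in the midpoint. This reflection exchanges the two means.\<close>

lemma normal_density_reflect: "normal_density u \<sigma> (u + v - t) = normal_density v \<sigma> t"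
proof -
  have "(v - t)\<^sup>2 = (t - v)\<^sup>2" by (rule power2_commute)
  then show ?thesis by (simp add: normal_density_def)
qed

text \<open>With equal variances the larger density belongs to the nearer mean: the quadratic terms
  cancel, leaving a comparison linear in \<open>t\<close>.\<close>

lemma normal_density_less_iff:
  assumes "\<sigma> > 0" and "u < v"
  shows "normal_density v \<sigma> t < normal_density u \<sigma> t \<longleftrightarrow> t < (u + v) / 2"
proof -
  have "(t - v)\<^sup>2 - (t - u)\<^sup>2 = (v - u) * (u + v - 2 * t)"
    by (simp add: power2_eq_square algebra_simps)
  then have "(t - u)\<^sup>2 < (t - v)\<^sup>2 \<longleftrightarrow> 0 < (v - u) * (u + v - 2 * t)"
    by linarith
  also have "\<dots> \<longleftrightarrow> t < (u + v) / 2"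
    using assms(2) by (simp add: zero_less_mult_iff) linarith
  finally show ?thesis
    using assms(1) by (simp add: normal_density_def divide_simps)
qed

lemma distr_max_refl_1d_fst:
  assumes "\<sigma> > 0"
  shows "distr (max_refl_1d u v \<sigma>) borel fst = normal u \<sigma>"
proof -
  interpret W: prob_space "uniform_measure lborel {0..1::real}" by (rule prob_space_unit_interval)
  have "distr (max_refl_1d u v \<sigma>) borel fst =
      distr (normal u \<sigma> \<Otimes>\<^sub>M uniform_measure lborel {0..1::real}) borel fst"
    unfolding max_refl_1d_def
    by (subst distr_distr[OF measurable_fst measurable_max_refl_1d])
      (rule distr_cong; auto simp: Let_def)
  \<comment> \<open>The target becomes the factor itself, with the same measurable sets, to match
    the form of \<open>distr_pair_fst\<close>.\<close>
  also have "\<dots> = distr (normal u \<sigma> \<Otimes>\<^sub>M uniform_measure lborel {0..1::real}) (normal u \<sigma>) fst"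
    by (intro distr_cong) simp_all
  finally show ?thesis
    by (simp add: W.distr_pair_fst)
qed

text \<open>Accepted draws contribute the density \<open>m = min p q\<close>. Rejected ones have
  density \<open>p - m\<close> and are reflected; since reflection exchanges \<open>p\<close> and
  \<open>q\<close> and fixes \<open>m\<close>, they arrive with density \<open>q - m\<close>. The
  two parts add up to \<open>q\<close>.\<close>

lemma distr_max_refl_1d_snd:
  assumes s: "\<sigma> > 0"
  shows "distr (max_refl_1d u v \<sigma>) borel snd = normal v \<sigma>"
proof (rule measure_eqI)
  let ?U = "uniform_measure lborel {0..1::real}"
  interpret W: prob_space ?U by (rule prob_space_unit_interval)
  define p where "p = normal_density u \<sigma>"
  define q where "q = normal_density v \<sigma>"
  define m where "m t = min (p t) (q t)" for t
  have [measurable]: "p \<in> borel_measurable borel" "q \<in> borel_measurable borel"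
      "m \<in> borel_measurable borel"
    unfolding p_def q_def m_def[abs_def] by measurable
  have pos: "0 < p t" "0 < q t" for t
    by (simp_all add: p_def q_def normal_density_pos[OF s])
  have refl: "p (u + v - t) = q t" "q (u + v - t) = p t" for t
    using normal_density_reflect[of u \<sigma> v t] normal_density_reflect[of v \<sigma> u t]
    by (simp_all add: p_def q_def add.commute)
  have m_nonneg: "0 \<le> m t" and m_le: "m t \<le> p t" "m t \<le> q t" for t
    using pos[of t] by (auto simp: m_def)
  show "sets (distr (max_refl_1d u v \<sigma>) borel snd) = sets (normal v \<sigma>)" by simp
  fix A assume "A \<in> sets (distr (max_refl_1d u v \<sigma>) borel snd)"
  then have [measurable]: "A \<in> sets borel" by simp
  let ?f = "\<lambda>(t, w). if w * p t \<le> q t then t else u + v - t"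
  have inner: "ennreal (p t) * (\<integral>\<^sup>+w. indicator A (?f (t, w)) \<partial>?U) =
      ennreal (m t) * indicator A t + ennreal (p t - m t) * indicator A (u + v - t)" for t
  proof -
    \<comment> \<open>As \<open>p t > 0\<close>, the test \<open>w * p t \<le> q t\<close> reads
      \<open>w \<le> r\<close>. The truncation \<open>min 1 r\<close> turns
      \<open>p t * r = q t\<close> into \<open>m t\<close>.\<close>
    define r where "r = q t / p t"
    have r: "0 \<le> r" "p t * min 1 r = m t" "p t * (1 - min 1 r) = p t - m t"
      using pos[of t] by (auto simp: r_def m_def min_def field_simps)
    have "indicator A (?f (t, w)) =
        indicator A t * indicator {..r} w + indicator A (u + v - t) * (indicator {r<..} w :: ennreal)" for w
      using pos[of t] by (auto simp: r_def indicator_def field_simps)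
    then have "(\<integral>\<^sup>+w. indicator A (?f (t, w)) \<partial>?U) =
        indicator A t * emeasure ?U {..r} + indicator A (u + v - t) * emeasure ?U {r<..}"
      by (simp add: nn_integral_add nn_integral_cmult_indicator del: emeasure_uniform_measure)
    also have "\<dots> = indicator A t * ennreal (min 1 r) + indicator A (u + v - t) * ennreal (1 - min 1 r)"
      by (simp only: emeasure_unit_interval_atMost[OF r(1)] emeasure_unit_interval_greaterThan[OF r(1)])
    finally have "ennreal (p t) * (\<integral>\<^sup>+w. indicator A (?f (t, w)) \<partial>?U) =
        indicator A t * (ennreal (p t) * ennreal (min 1 r)) +
        indicator A (u + v - t) * (ennreal (p t) * ennreal (1 - min 1 r))"
      by (simp only: distrib_left mult.left_commute[of "ennreal (p t)"])
    then show ?thesis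
      using pos(1)[of t] by (simp only: ennreal_mult'[symmetric] less_imp_le r mult.commute)
  qed
  have "emeasure (distr (max_refl_1d u v \<sigma>) borel snd) A =
      emeasure (distr (normal u \<sigma> \<Otimes>\<^sub>M ?U) borel ?f) A"
    unfolding max_refl_1d_def
    by (subst distr_distr[OF measurable_snd measurable_max_refl_1d])
      (intro arg_cong2[where f = emeasure] distr_cong refl; auto simp: Let_def p_def q_def)
  also have "\<dots> = (\<integral>\<^sup>+p. indicator A (?f p) \<partial>(normal u \<sigma> \<Otimes>\<^sub>M ?U))"
    by (simp add: nn_integral_distr flip: nn_integral_indicator)
  also have "\<dots> = (\<integral>\<^sup>+t. \<integral>\<^sup>+w. indicator A (?f (t, w)) \<partial>?U \<partial>normal u \<sigma>)"
    by (rule W.nn_integral_fst[symmetric]) measurable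
  also have "\<dots> = (\<integral>\<^sup>+t. ennreal (p t) * (\<integral>\<^sup>+w. indicator A (?f (t, w)) \<partial>?U) \<partial>lborel)"
    unfolding normal_def p_def[symmetric] by (rule nn_integral_density) measurable
  also have "\<dots> = (\<integral>\<^sup>+t. ennreal (m t) * indicator A t \<partial>lborel) +
      (\<integral>\<^sup>+t. ennreal (p t - m t) * indicator A (u + v - t) \<partial>lborel)"
    unfolding inner by (rule nn_integral_add) measurable
  \<comment> \<open>The substitution of \<open>u + v - t\<close> for \<open>t\<close> carries the
    excess of \<open>p\<close> over \<open>m\<close> to that of \<open>q\<close> over
    \<open>m\<close>.\<close>
  also have "(\<integral>\<^sup>+t. ennreal (p t - m t) * indicator A (u + v - t) \<partial>lborel) =
      (\<integral>\<^sup>+t. ennreal (q t - m t) * indicator A t \<partial>lborel)"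
    by (subst nn_integral_real_affine[where t = "u + v" and c = "-1"])
      (simp_all add: refl m_def min.commute)
  also have "(\<integral>\<^sup>+t. ennreal (m t) * indicator A t \<partial>lborel) + \<dots> =
      (\<integral>\<^sup>+t. ennreal (q t) * indicator A t \<partial>lborel)"
    by (subst nn_integral_add[symmetric])
      (auto intro!: nn_integral_cong simp: m_nonneg m_le simp flip: distrib_right ennreal_plus)
  also have "\<dots> = emeasure (normal v \<sigma>) A"
    by (simp add: normal_def q_def emeasure_density)
  finally show "emeasure (distr (max_refl_1d u v \<sigma>) borel snd) A = emeasure (normal v \<sigma>) A" .
qed

text \<open>Rejection means that \<open>w\<close> times the density at \<open>u\<close> exceeds the
  density at \<open>v\<close>. With \<open>w \<le> 1\<close> the density at \<open>u\<close> is then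
  the larger, which places the draw below the midpoint.\<close>

lemma AE_max_refl_1d:
  assumes "\<sigma> > 0" and "u < v"
  shows "AE p in max_refl_1d u v \<sigma>. fst p = snd p \<or> fst p < (u + v) / 2 \<and> snd p = u + v - fst p"
proof -
  let ?U = "uniform_measure lborel {0..1::real}"
  interpret N: prob_space "normal u \<sigma>" by (rule prob_space_normal[OF assms(1)])
  interpret W: prob_space ?U by (rule prob_space_unit_interval)
  interpret pair_prob_space "normal u \<sigma>" ?U ..
  have meas: "{p \<in> space (normal u \<sigma> \<Otimes>\<^sub>M ?U). snd p \<le> 1} \<in> sets (normal u \<sigma> \<Otimes>\<^sub>M ?U)"
    by measurable
  \<comment> \<open>\<open>uniform_measure\<close> lives on the whole line, so this bound holds only
    almost everywhere and has to be lifted to the product.\<close>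
  have "AE w in ?U. w \<le> 1"
    by (rule AE_uniform_measureI) auto
  then have "AE p in normal u \<sigma> \<Otimes>\<^sub>M ?U. snd p \<le> 1"
    by (intro AE_pair_measure[OF meas]) simp_all
  then show ?thesis
    unfolding max_refl_1d_def
  proof (subst AE_distr_iff[OF measurable_max_refl_1d], goal_cases)
    case 2
    then show ?case
    proof eventually_elim
      case (elim p)
      obtain t w where p: "p = (t, w)" by force
      have "t < (u + v) / 2" if "\<not> w * normal_density u \<sigma> t \<le> normal_density v \<sigma> t"
      proof -
        have "w * normal_density u \<sigma> t \<le> 1 * normal_density u \<sigma> t"
          using elim p by (intro mult_right_mono) simp_all
        with that show ?thesis
          using normal_density_less_iff[OF assms, of t] by linarith
      qed
      then show ?case by (auto simp: p Let_def)
    qed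
  qed measurable
qed

subsection \<open>Maximality and the reflection coupling\<close>

text \<open>The set \<open>A\<close> separates the coordinates whenever they differ, so it detects
  all of the mass off the diagonal and attains the supremum.\<close>

lemma maximal_couplingI:
  fixes \<mu> \<nu> :: "'a::{second_countable_topology, t2_space} measure"
  assumes P: "coupling \<mu> \<nu> P" and A: "A \<in> sets borel"
    and AE: "AE p in P. fst p \<noteq> snd p \<longrightarrow> fst p \<in> A \<and> snd p \<notin> A"
  shows "maximal_coupling \<mu> \<nu> P"
proof -
  have [measurable_cong]: "sets P = sets (borel \<Otimes>\<^sub>M borel)" and \<mu>: "\<mu> = distr P borel fst"
      and \<nu>: "\<nu> = distr P borel snd"
    using P by (auto simp: coupling_def)
  interpret prob_space P
    using P by (simp add: coupling_def)
  have space: "space P = UNIV"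
    using sets_eq_imp_space_eq[OF \<open>sets P = sets (borel \<Otimes>\<^sub>M borel)\<close>] by (simp add: space_pair_measure)
  have [measurable]: "fst \<in> P \<rightarrow>\<^sub>M borel" "snd \<in> P \<rightarrow>\<^sub>M borel"
    by measurable
  define D where "D = {p :: 'a \<times> 'a. fst p \<noteq> snd p}"
  \<comment> \<open>The diagonal is closed in a Hausdorff square, and second countability makes the
    product sigma-algebra the Borel one.\<close>
  have "{p \<in> space P. \<not> (fst p = snd p)} \<in> events" by measurable
  then have D_events: "D \<in> events" by (simp add: D_def space)
  have \<mu>_eq: "measure \<mu> B = prob (fst -` B)" and \<nu>_eq: "measure \<nu> B = prob (snd -` B)"
    if "B \<in> sets borel" for B
    using that by (simp_all add: \<mu> \<nu> measure_distr space)
  have events: "fst -` B \<in> events" "snd -` B \<in> events" if "B \<in> sets borel" for B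
    using measurable_sets[of fst P borel B] measurable_sets[of snd P borel B] that
    by (simp_all add: space)
  \<comment> \<open>Off \<open>D\<close> the coordinates agree, so the two preimages of
    \<open>B\<close> differ only inside \<open>D\<close>.\<close>
  have le: "\<bar>measure \<mu> B - measure \<nu> B\<bar> \<le> prob D" if B: "B \<in> sets borel" for B
  proof -
    have "prob (fst -` B) \<le> prob (snd -` B \<union> D)" "prob (snd -` B) \<le> prob (fst -` B \<union> D)"
      by (intro finite_measure_mono sets.Un events[OF B] D_events; auto simp: D_def)+
    moreover have "prob (snd -` B \<union> D) \<le> prob (snd -` B) + prob D"
        "prob (fst -` B \<union> D) \<le> prob (fst -` B) + prob D"
      by (intro measure_Un_le events[OF B] D_events)+
    ultimately show ?thesis
      by (simp add: \<mu>_eq[OF B] \<nu>_eq[OF B])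
  qed
  \<comment> \<open>Up to a null set, \<open>D\<close> lies in the first preimage of
    \<open>A\<close> and misses the second, while off \<open>D\<close> the preimages coincide. The
    union is thus almost surely disjoint.\<close>
  have "prob (fst -` A) = prob (snd -` A \<union> D)"
    by (intro finite_measure_eq_AE sets.Un events[OF A] D_events)
      (use AE in eventually_elim, auto simp: D_def)
  also have "\<dots> = prob (snd -` A) + prob D"
    by (intro measure_Un_AE) (use AE events[OF A] D_events in
      \<open>auto simp: D_def fmeasurable_eq_sets elim: eventually_mono\<close>)
  finally have "prob D = \<bar>measure \<mu> A - measure \<nu> A\<bar>"
    by (simp add: \<mu>_eq[OF A] \<nu>_eq[OF A])
  then have "(SUP B\<in>sets borel. \<bar>measure \<mu> B - measure \<nu> B\<bar>) = prob D"
    using A le by (intro cSup_eq_maximum) auto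
  moreover have "\<P>(p in P. fst p = snd p) = 1 - prob D"
    using D_events unfolding D_def
    by (subst prob_compl[symmetric]) (auto simp: space intro!: arg_cong[where f = prob])
  ultimately show ?thesis
    using P by (simp add: maximal_coupling_def)
qed

section \<open>The output in dimension d\<close>

lemma outer_mult_vec: "outer e *v w = (e \<bullet> w) *\<^sub>R e"
  by (simp add: outer_def matrix_vector_mult_def inner_vec_def vec_eq_iff sum_distrib_left
      mult.assoc) (simp add: mult.commute sum_distrib_left[symmetric])

text \<open>Independence of \<open>p\<close> and \<open>z\<close> makes the law of
  \<open>(f p, z)\<close> a product in which only the law of \<open>f p\<close> matters. Taking
  \<open>f\<close> as \<open>fst\<close> and as \<open>snd\<close> gives both marginals, however the
  two components of \<open>p\<close> depend on each other.\<close>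

lemma distr_pair_replace_coordinate:
  fixes \<mu> e :: "real ^ 'n"
  assumes s: "\<sigma> > 0" and e: "norm e = 1"
    and f: "f \<in> D \<rightarrow>\<^sub>M borel" and D: "distr D borel f = normal (e \<bullet> \<mu>) \<sigma>"
  shows "distr (D \<Otimes>\<^sub>M mvnormal 0 (\<sigma>\<^sup>2 *\<^sub>R mat 1)) borel
      (\<lambda>(p, z). f p *\<^sub>R e + (\<mu> - (e \<bullet> \<mu>) *\<^sub>R e) + (z - (e \<bullet> z) *\<^sub>R e)) =
    mvnormal \<mu> (\<sigma>\<^sup>2 *\<^sub>R mat 1)"
proof -
  let ?Z = "mvnormal (0 :: real ^ 'n) (\<sigma>\<^sup>2 *\<^sub>R mat 1)"
  note f [measurable]
  interpret Z: prob_space ?Z by (rule prob_space_mvnormal[OF s])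
  have Z: "distr ?Z borel (\<lambda>z. z) = ?Z"
    by (rule distr_id2) simp
  have "normal (e \<bullet> \<mu>) \<sigma> \<Otimes>\<^sub>M ?Z = distr (D \<Otimes>\<^sub>M ?Z) (borel \<Otimes>\<^sub>M borel) (\<lambda>(p, z). (f p, z))"
    using pair_measure_distr[of f D borel "\<lambda>z. z" ?Z borel]
    by (simp add: D Z Z.sigma_finite_measure_axioms)
  then show ?thesis
    unfolding distr_replace_coordinate[OF s e, of \<mu>, symmetric]
    by (simp add: distr_distr comp_def split_beta')
qed

theorem lemma4p5:
  fixes x y :: "real ^ 'n" and \<sigma> :: real
  assumes "\<sigma> > 0" and "x \<noteq> y"
  shows "maximal_reflection_coupling x y \<sigma> (max_refl x y \<sigma>)"
proof -
  let ?Z = "mvnormal (0 :: real ^ 'n) (\<sigma>\<^sup>2 *\<^sub>R mat 1)"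
  define e where "e = unit_dir x y"
  define D where "D = max_refl_1d (e \<bullet> x) (e \<bullet> y) \<sigma>"
  define perp where "perp w = w - (e \<bullet> w) *\<^sub>R e" for w
  \<comment> \<open>\<open>X fst\<close> and \<open>X snd\<close> are the two output vectors.
    Writing \<open>perp x\<close> for the orthogonal part of the midpoint is justified by
    \<open>perp_m\<close>.\<close>
  define X where "X f = (\<lambda>(p :: real \<times> real, z). f p *\<^sub>R e + perp x + perp z)" for f
  define H where "H q = (X fst q, X snd q)" for q
  have e: "norm e = 1"
    using assms(2) by (simp add: e_def unit_dir_def)
  then have ee: "e \<bullet> e = 1"
    by (simp add: norm_eq_1)
  \<comment> \<open>The means differ only along \<open>e\<close>, with \<open>y\<close> ahead of
    \<open>x\<close>: hence the ordered one-dimensional means and the common orthogonal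
    part.\<close>
  have y: "y = x + norm (y - x) *\<^sub>R e"
    using assms(2) by (simp add: e_def unit_dir_def)
  have less: "e \<bullet> x < e \<bullet> y"
    using assms(2) by (subst y) (simp add: inner_add_right ee)
  have perp_y: "perp y = perp x"
    unfolding perp_def by (subst (1 2) y) (simp add: inner_add_right ee algebra_simps)
  have perp_inner: "e \<bullet> perp w = 0" for w
    by (simp add: perp_def inner_diff_right ee)
  have proj: "(mat 1 - outer e) *v w = perp w" for w
    by (simp add: matrix_vector_mult_diff_rdistrib outer_mult_vec perp_def)
  have reflect: "(mat 1 - 2 *\<^sub>R outer e) *v w = w - (2 * (e \<bullet> w)) *\<^sub>R e" for w
    by (simp add: matrix_vector_mult_diff_rdistrib outer_mult_vec flip: scaleR_matrix_vector_assoc)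
  have perp_m: "perp ((y + x) /\<^sub>R 2) = perp x"
  proof -
    have "perp ((y + x) /\<^sub>R 2) = (perp y + perp x) /\<^sub>R 2"
      by (simp add: perp_def inner_add_right algebra_simps)
    also have "\<dots> = perp x"
      by (simp add: perp_y flip: scaleR_2)
    finally show ?thesis .
  qed
  have [measurable_cong]: "sets D = sets (borel \<Otimes>\<^sub>M borel)"
    by (simp add: D_def)
  have [measurable]: "perp \<in> borel_measurable borel"
    unfolding perp_def[abs_def] by measurable
  have [measurable]: "X f \<in> borel_measurable ((borel \<Otimes>\<^sub>M borel) \<Otimes>\<^sub>M borel)"
    if [measurable]: "f \<in> borel_measurable (borel \<Otimes>\<^sub>M borel)" for f
    unfolding X_def by measurable
  have H [measurable]: "H \<in> D \<Otimes>\<^sub>M ?Z \<rightarrow>\<^sub>M borel \<Otimes>\<^sub>M borel"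
    unfolding H_def[abs_def] by measurable
  have max_refl: "max_refl x y \<sigma> = distr (D \<Otimes>\<^sub>M ?Z) (borel \<Otimes>\<^sub>M borel) H"
    unfolding max_refl_def Let_def e_def[symmetric] D_def[symmetric] proj perp_m
    by (intro distr_cong) (auto simp: H_def X_def)
  interpret D: prob_space D
    unfolding D_def by (rule prob_space_max_refl_1d[OF assms(1)])
  interpret Z: prob_space ?Z by (rule prob_space_mvnormal[OF assms(1)])
  interpret pair_prob_space D ?Z ..
  have "distr D borel fst = normal (e \<bullet> x) \<sigma>" "distr D borel snd = normal (e \<bullet> y) \<sigma>"
    unfolding D_def
    by (simp_all add: distr_max_refl_1d_fst[OF assms(1)] distr_max_refl_1d_snd[OF assms(1)])
  then have "distr (D \<Otimes>\<^sub>M ?Z) borel (X fst) = mvnormal x (\<sigma>\<^sup>2 *\<^sub>R mat 1)"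
      "distr (D \<Otimes>\<^sub>M ?Z) borel (X snd) = mvnormal y (\<sigma>\<^sup>2 *\<^sub>R mat 1)"
    using distr_pair_replace_coordinate[OF assms(1) e, of fst D x]
      distr_pair_replace_coordinate[OF assms(1) e, of snd D y]
    by (simp_all add: X_def flip: perp_def) (simp_all add: perp_y)
  then have coupling: "coupling (mvnormal x (\<sigma>\<^sup>2 *\<^sub>R mat 1)) (mvnormal y (\<sigma>\<^sup>2 *\<^sub>R mat 1))
      (max_refl x y \<sigma>)"
    unfolding coupling_def max_refl
    by (simp add: prob_space_distr distr_distr comp_def H_def)
  let ?good = "\<lambda>p. fst p = snd p \<or>
    fst p < (e \<bullet> x + e \<bullet> y) / 2 \<and> snd p = e \<bullet> x + e \<bullet> y - fst p"
  have "AE p in distr (D \<Otimes>\<^sub>M ?Z) D fst. ?good p"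
    unfolding Z.distr_pair_fst unfolding D_def by (rule AE_max_refl_1d[OF assms(1) less])
  then have good: "AE q in D \<Otimes>\<^sub>M ?Z. ?good (fst q)"
    by (rule AE_distrD[rotated]) measurable
  \<comment> \<open>The half-space ends at the midpoint hyperplane. Its membership test reads only
    the coordinate along \<open>e\<close>, which is \<open>f (fst q)\<close> for
    \<open>X f q\<close>, and reflection sends a coordinate below the midpoint above it.\<close>
  define A where "A = {z. e \<bullet> z < (e \<bullet> x + e \<bullet> y) / 2}"
  have [measurable]: "A \<in> sets borel"
    unfolding A_def by measurable
  have "AE p in max_refl x y \<sigma>. fst p \<noteq> snd p \<longrightarrow> fst p \<in> A \<and> snd p \<notin> A"
    unfolding max_refl
  proof (subst AE_distr_iff[OF H], goal_cases)
    case 2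
    from good show ?case
    proof eventually_elim
      case (elim q)
      have "e \<bullet> X f q = f (fst q)" for f
        by (simp add: X_def case_prod_beta inner_add_right ee perp_inner)
      with elim show ?case
        by (auto simp: H_def A_def X_def case_prod_beta field_simps)
    qed
  qed measurable
  with coupling have "maximal_coupling (mvnormal x (\<sigma>\<^sup>2 *\<^sub>R mat 1)) (mvnormal y (\<sigma>\<^sup>2 *\<^sub>R mat 1))
      (max_refl x y \<sigma>)"
    by (intro maximal_couplingI) auto
  moreover have "AE p in max_refl x y \<sigma>. fst p \<noteq> snd p \<longrightarrow>
      snd p - y = (mat 1 - 2 *\<^sub>R outer e) *v (fst p - x)"
    unfolding max_refl reflect
  proof (subst AE_distr_iff[OF H], goal_cases)
    case 2
    have x_eq: "x = perp x + (e \<bullet> x) *\<^sub>R e"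
      by (simp add: perp_def)
    have y_eq: "y = perp x + (e \<bullet> y) *\<^sub>R e"
      unfolding perp_y[symmetric] by (simp add: perp_def)
    from good show ?case
    proof eventually_elim
      case (elim q)
      obtain a b z where q: "q = ((a, b), z)" by (metis surj_pair)
      \<comment> \<open>Both increments share \<open>perp z\<close>. If
        \<open>b = e \<bullet> x + e \<bullet> y - a\<close>, their coordinates along
        \<open>e\<close> are opposite, which is reflection in the hyperplane orthogonal to
        \<open>e\<close>. If \<open>a = b\<close>, the outputs coincide and nothing is
        required.\<close>
      have X: "X fst q - x = (a - e \<bullet> x) *\<^sub>R e + perp z" "X snd q - y = (b - e \<bullet> y) *\<^sub>R e + perp z"
        by (subst x_eq y_eq; simp add: X_def q algebra_simps)+
      have "X snd q - y = X fst q - x - (2 * (e \<bullet> (X fst q - x))) *\<^sub>R e"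
        if "b = e \<bullet> x + e \<bullet> y - a"
        unfolding X that by (simp add: inner_add_right ee perp_inner vec_eq_iff algebra_simps)
      moreover have "X fst q = X snd q" if "a = b"
        using that by (simp add: X_def q)
      ultimately show ?case
        using elim by (auto simp: H_def q)
    qed
  qed measurable
  ultimately show ?thesis
    unfolding maximal_reflection_coupling_def
    by (simp add: case_prod_beta Let_def e_def)
qed

end
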